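(* Let $\lambda,D\in\mathbb C^\times$, $\psi=\psi_\lambda$ and $\psi^D=\psi_{\lambda D}$. For each infinite-dimensional irreducible unitary representation $\pi$ of $\mathrm{GL}_2(\mathbb C)$ with trivial central character, there exists an irreducible unitary representation $\sigma$ of $\mathrm{SL}_2(\mathbb C)$ corresponding to $\pi$, i.e. such that $$ i_{\pi,\psi}\big(n(z/4D)\,w_0\big)=\frac{4\,\Delta_{D,\psi}(z)\,\epsilon(\pi,1/2,\psi)}{L(\pi,1/2)}\; j_{\sigma,\psi^D}\big(w\,s(z)\big)\qquad\text{for all } z\in\mathbb C^\times. $$ The correspondence is given by $$\pi_{\mu,m}\longmapsto\sigma_{\frac12\mu,\frac12 m},\qquad \text{for } \mu\in i\mathbb R \text{ and } m \text{ even, or } \mu\in(0,\tfrac12) \text{ and } m=0 .$$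
   Context: Notation. $n(x)=\begin{pmatrix}1&x\\0&1\end{pmatrix}$, $s(a)=\begin{pmatrix}a&0\\0&a^{-1}\end{pmatrix}$, $w_0=\begin{pmatrix}0&1\\1&0\end{pmatrix}$, $w=\begin{pmatrix}0&-1\\1&0\end{pmatrix}$ (so $w\,s(z)=s(z^{-1})w$). $e(x)=e^{2\pi i x}$, $\mathrm{Tr}\,z=z+\bar z$, $\|z\|=|z|^2$, $\psi_\lambda(z)=e(\mathrm{Tr}(\lambda z))$, so $\psi^D(z)=\psi(Dz)$. Transfer factor. $\gamma(z,\psi^D)=1/\sqrt{\|2D\|}$ and $\Delta_{D,\psi}(z)=\gamma(z,\psi^D)\,\psi(2D/z)\,\sqrt{\|z\|}$. Representations. Let $\chi_{\nu,l}(z)=\|z\|^{\nu}(z/|z|)^l$. For $\mu\in\mathbb C$, $m\in\mathbb Z$, $\pi_{\mu,m}$ is the principal series of $\mathrm{GL}_2(\mathbb C)$ unitarily induced from the character $\mathrm{diag}(a,b)\mapsto\chi_{\mu,m/2}(a)\chi_{-\mu,-m/2}(b)$ of the upper triangular Borel subgroup if $m$ is even, and from $\mathrm{diag}(a,b)\mapsto\chi_{\mu,(m+1)/2}(a)\chi_{-\mu,-(m-1)/2}(b)$ if $m$ is odd; $\sigma_{\mu,m}$ is its restriction to $\mathrm{SL}_2(\mathbb C)$. They are irreducible and unitary when $\mathrm{Re}\,\mu=0$, or when $\mu\in(0,\frac12)$ and $m=0$. Up to equivalence, the infinite-dimensional irreducible unitary representations of $\mathrm{GL}_2(\mathbb C)$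 with trivial central character are these $\pi_{\mu,m}$ with $m$ even, and those of $\mathrm{SL}_2(\mathbb C)$ are these $\sigma_{\mu,m}$. $L$- and $\epsilon$-factors. For $m$ even, $L(\pi_{\mu,m},s)=L(s,\chi_{\mu,m/2})L(s,\chi_{-\mu,-m/2})$ with $L(s,\chi_{\nu,l})=2(2\pi)^{-(s+\nu+|l|/2)}\Gamma(s+\nu+|l|/2)$; and $\epsilon(\pi_{\mu,m},s,\psi_\lambda)=i^{|m|}\|\lambda\|^{2s-1}$, so that $\epsilon(\pi_{\mu,m},1/2,\psi)=(-1)^{m/2}$. Complex Bessel functions. With $J_\nu$ the classical Bessel function of the first kind, put $J_{\mu,m}(z)=J_{-2\mu-\frac12m}(z)\,J_{-2\mu+\frac12m}(\bar z)$ (with $\arg\bar z=-\arg z$; the product does not depend on the choice of $\arg z$ modulo $2\pi$). For $u\in\mathbb C^\times$ put $$\mathcal B_{\mu,m}(u)=\frac{2\pi^2}{\sin(2\pi\mu)}\big(J_{\mu,m}(4\pi u)-J_{-\mu,-m}(4\pi u)\big)\ (m \text{ even}),\qquad \mathcal B_{\mu,m}(u)=\frac{2\pi^2 i}{\cos(2\pi\mu)}\big(J_{\mu,m}(4\pi u)+J_{-\mu,-m}(4\pi u)\big)\ (m \text{ odd}),$$ with the limit in $\mu$ taken when the denominator vanishes. One has $\mathcal B_{\mu,m}(-u)=(-1)^m\mathcal B_{\mu,m}(u)$. (The paper writes $\boldsymbol J_{\mu,m}(u^2)$ for $\mathcal B_{\mu,m}(u)$.) Relative Bessel function. For $\pi=\pi_{\mu,m}$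 with $m$ even and $x\in\mathbb C^\times$, $$i_{\pi,\psi_\lambda}(n(x)w_0)=\frac{1}{L(\pi,1/2)}\,e\big(\mathrm{Tr}(\lambda/2x)\big)\,\Big|\frac{\lambda}{2x}\Big|\,\mathcal B_{\frac12\mu,\frac12m}\Big(\frac{\lambda}{4x}\Big).$$ Bessel function on $\mathrm{SL}_2(\mathbb C)$. For $\sigma=\sigma_{\mu,m}$ and $a\in\mathbb C^\times$, $j_{\sigma,\psi_\lambda}(s(a)w)=(-1)^m|\lambda a^2|\,\mathcal B_{\mu,m}(\lambda a)$. When $\psi=\psi_\lambda$ is replaced by $\psi^D=\psi_{\lambda D}$ the Haar measures are kept fixed with respect to $\psi$ and the formula is renormalized by the extra factor $\sqrt{\|D\|}$, i.e. $$j_{\sigma,\psi^D}(s(a)w)=\sqrt{\|D\|}\,(-1)^m|\lambda D a^2|\,\mathcal B_{\mu,m}(\lambda D a).$$ *)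

theory Defs
  imports "HOL-Analysis.Analysis"
begin

section \<open>Complex Hilbert spaces and unitary representations\<close>

text \<open>
  The norm comes from a real inner product for which the space is complete, and
  \<open>norm (scaleC c x) = cmod c * norm x\<close>; by polarisation
  \<open>inner x y + \<i> * inner x (scaleC \<i> y)\<close> is then a Hermitian inner product
  (linear in the first variable) inducing the norm.
\<close>

class complex_hilbert_space = real_inner + complete_space +
  fixes scaleC :: "complex \<Rightarrow> 'a \<Rightarrow> 'a"
  assumes scaleC_add_right: "scaleC c (x + y) = scaleC c x + scaleC c y"
    and scaleC_add_left: "scaleC (c + d) x = scaleC c x + scaleC d x"
    and scaleC_scaleC: "scaleC c (scaleC d x) = scaleC (c * d) x"
    and scaleC_of_real: "scaleC (of_real r) x = scaleR r x"
    and norm_scaleC: "norm (scaleC c x) = cmod c * norm x"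

type_synonym cmat2 = "complex^2^2"

definition GL2 :: "cmat2 set"
  where "GL2 = {g. invertible g}"

definition SL2 :: "cmat2 set"
  where "SL2 = {g. det g = 1}"

definition U2 :: "cmat2 set"
  where "U2 = {k. k ** (\<chi> i j. cnj (k $ j $ i)) = mat 1}"

text \<open>
  Only the values of \<open>\<rho>\<close> on the group \<open>G\<close> matter. A complex-linear surjective isometry of a
  Hilbert space is the same as a unitary operator; \<open>\<rho>\<close> is required to be strongly continuous.
\<close>

definition unitary_rep ::
    "cmat2 set \<Rightarrow> (cmat2 \<Rightarrow> 'h::complex_hilbert_space \<Rightarrow> 'h) \<Rightarrow> bool"
  where "unitary_rep G \<rho> \<longleftrightarrow>
    (\<forall>g\<in>G. (\<forall>v w. \<rho> g (v + w) = \<rho> g v + \<rho> g w) \<and>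
            (\<forall>c v. \<rho> g (scaleC c v) = scaleC c (\<rho> g v)) \<and>
            (\<forall>v. norm (\<rho> g v) = norm v) \<and> surj (\<rho> g)) \<and>
    (\<forall>g\<in>G. \<forall>h\<in>G. \<rho> (g ** h) = \<rho> g \<circ> \<rho> h) \<and>
    (\<forall>v. continuous_on G (\<lambda>g. \<rho> g v))"

definition closed_csubspace :: "'h::complex_hilbert_space set \<Rightarrow> bool"
  where "closed_csubspace W \<longleftrightarrow> closed W \<and> 0 \<in> W \<and>
    (\<forall>v\<in>W. \<forall>w\<in>W. v + w \<in> W) \<and> (\<forall>c. \<forall>v\<in>W. scaleC c v \<in> W)"

definition irreducible_unitary_rep ::
    "cmat2 set \<Rightarrow> (cmat2 \<Rightarrow> 'h::complex_hilbert_space \<Rightarrow> 'h) \<Rightarrow> bool"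
  where "irreducible_unitary_rep G \<rho> \<longleftrightarrow>
    unitary_rep G \<rho> \<and> (UNIV :: 'h set) \<noteq> {0} \<and>
    (\<forall>W. closed_csubspace W \<and> (\<forall>g\<in>G. \<rho> g ` W \<subseteq> W) \<longrightarrow> W = {0} \<or> W = UNIV)"

definition infinite_dimensional :: "'h::complex_hilbert_space itself \<Rightarrow> bool"
  where "infinite_dimensional _ \<longleftrightarrow> \<not> (\<exists>B :: 'h set. finite B \<and> span B = UNIV)"

definition trivial_central_character ::
    "(cmat2 \<Rightarrow> 'h::complex_hilbert_space \<Rightarrow> 'h) \<Rightarrow> bool"
  where "trivial_central_character \<rho> \<longleftrightarrow> (\<forall>c v. c \<noteq> 0 \<longrightarrow> \<rho> (mat c) v = v)"

section \<open>Principal series\<close>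

definition cabs :: "complex \<Rightarrow> real"  \<comment> \<open>the module of \<open>\<complex>\<close>, written \<open>\<parallel>z\<parallel>\<close> in the literature\<close>
  where "cabs z = (cmod z)\<^sup>2"

definition chi :: "complex \<Rightarrow> int \<Rightarrow> complex \<Rightarrow> complex"
  where "chi \<nu> l z = of_real (cabs z) powr \<nu> * (z / of_real (cmod z)) powi l"

definition borel_char :: "complex \<Rightarrow> int \<Rightarrow> complex \<Rightarrow> complex \<Rightarrow> complex"
  where "borel_char \<mu> m a d =
    (if even m then chi \<mu> (m div 2) a * chi (- \<mu>) (- (m div 2)) d
     else chi \<mu> ((m + 1) div 2) a * chi (- \<mu>) (- ((m - 1) div 2)) d)"

text \<open>
  The space of continuous vectors of the normalised induction, on which the group acts by right
  translation. The square root of the modulus of \<open>diag(a, d)\<close> is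
  \<open>sqrt (cabs (a / d)) = cmod (a / d)\<close>. The functions vanish off \<open>GL2\<close> by convention.
\<close>

definition induced_space :: "complex \<Rightarrow> int \<Rightarrow> (cmat2 \<Rightarrow> complex) set"
  where "induced_space \<mu> m = {f. continuous_on GL2 f \<and> (\<forall>g. g \<notin> GL2 \<longrightarrow> f g = 0) \<and>
    (\<forall>a b d. \<forall>g\<in>GL2. a \<noteq> 0 \<longrightarrow> d \<noteq> 0 \<longrightarrow>
       f (vector [vector [a, b], vector [0, d]] ** g)
         = borel_char \<mu> m a d * of_real (cmod (a / d)) * f g)}"

text \<open>
  \<open>is_principal_series G \<rho> \<mu> m\<close> says that the unitary representation \<open>\<rho>\<close> of \<open>G\<close> is (up to
  unitary equivalence) the restriction to \<open>G\<close> of the principal series with parameters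
  \<open>(\<mu>, m)\<close>: the Hilbert space is a completion of the induced space, i.e. the latter embeds
  \<open>G\<close>-equivariantly, continuously (for uniform convergence on the maximal compact subgroup
  \<open>U2\<close>) and with dense image. So \<open>G = GL2\<close> gives \<open>\<pi>\<^sub>\<mu>\<^sub>,\<^sub>m\<close> and \<open>G = SL2\<close> gives \<open>\<sigma>\<^sub>\<mu>\<^sub>,\<^sub>m\<close>. For \<open>Re \<mu> = 0\<close>
  the completion is the one for the \<open>L\<^sup>2\<close> norm on \<open>U2\<close>; for the complementary series it is the
  one for the norm given by the standard intertwining operator. In both cases the invariant
  inner product is unique up to a scalar, hence need not be specified.
\<close>

definition is_principal_series ::
    "cmat2 set \<Rightarrow> (cmat2 \<Rightarrow> 'h::complex_hilbert_space \<Rightarrow> 'h) \<Rightarrow> complex \<Rightarrow> int \<Rightarrow> bool"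
  where "is_principal_series G \<rho> \<mu> m \<longleftrightarrow> (\<exists>T :: (cmat2 \<Rightarrow> complex) \<Rightarrow> 'h.
    (\<forall>f\<in>induced_space \<mu> m. \<forall>f'\<in>induced_space \<mu> m. T (\<lambda>h. f h + f' h) = T f + T f') \<and>
    (\<forall>c. \<forall>f\<in>induced_space \<mu> m. T (\<lambda>h. c * f h) = scaleC c (T f)) \<and>
    inj_on T (induced_space \<mu> m) \<and>
    closure (T ` induced_space \<mu> m) = UNIV \<and>
    (\<exists>C. \<forall>f\<in>induced_space \<mu> m. \<forall>M. (\<forall>k\<in>U2. cmod (f k) \<le> M) \<longrightarrow> norm (T f) \<le> C * M) \<and>
    (\<forall>g\<in>G. \<forall>f\<in>induced_space \<mu> m. T (\<lambda>h. f (h ** g)) = \<rho> g (T f)))"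

definition unitary_parameter :: "complex \<Rightarrow> int \<Rightarrow> bool"
  where "unitary_parameter \<mu> m \<longleftrightarrow>
    Re \<mu> = 0 \<or> (Im \<mu> = 0 \<and> 0 < Re \<mu> \<and> Re \<mu> < 1/2 \<and> m = 0)"

section \<open>Matrices, additive characters and the transfer factor\<close>

definition unip :: "complex \<Rightarrow> cmat2"  \<comment> \<open>\<open>n(x)\<close>\<close>
  where "unip x = vector [vector [1, x], vector [0, 1]]"

definition tor :: "complex \<Rightarrow> cmat2"  \<comment> \<open>\<open>s(a)\<close>\<close>
  where "tor a = vector [vector [a, 0], vector [0, inverse a]]"

definition w0 :: cmat2
  where "w0 = vector [vector [0, 1], vector [1, 0]]"

definition w :: cmat2
  where "w = vector [vector [0, - 1], vector [1, 0]]"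

definition e_char :: "complex \<Rightarrow> complex"
  where "e_char x = exp (2 * of_real pi * \<i> * x)"

definition Tr :: "complex \<Rightarrow> complex"
  where "Tr z = z + cnj z"

definition psi :: "complex \<Rightarrow> complex \<Rightarrow> complex"
  where "psi lam z = e_char (Tr (lam * z))"

definition gamma_factor :: "complex \<Rightarrow> real"
  where "gamma_factor D = 1 / sqrt (cabs (2 * D))"

text \<open>The transfer factor for \<open>D\<close> and the additive character \<open>psi lam\<close>.\<close>

definition transfer_factor :: "complex \<Rightarrow> complex \<Rightarrow> complex \<Rightarrow> complex"
  where "transfer_factor D lam z =
    of_real (gamma_factor D) * psi lam (2 * D / z) * of_real (sqrt (cabs z))"

section \<open>Local factors of \<open>\<pi>\<^sub>\<mu>\<^sub>,\<^sub>m\<close> (\<open>m\<close> even)\<close>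

definition L_char :: "complex \<Rightarrow> complex \<Rightarrow> int \<Rightarrow> complex"
  where "L_char s \<nu> l =
    2 * of_real (2 * pi) powr (- (s + \<nu> + of_int \<bar>l\<bar> / 2)) * Gamma (s + \<nu> + of_int \<bar>l\<bar> / 2)"

definition L_factor :: "complex \<Rightarrow> int \<Rightarrow> complex \<Rightarrow> complex"
  where "L_factor \<mu> m s = L_char s \<mu> (m div 2) * L_char s (- \<mu>) (- (m div 2))"

definition eps_factor :: "complex \<Rightarrow> int \<Rightarrow> complex \<Rightarrow> complex \<Rightarrow> complex"
  where "eps_factor \<mu> m s lam = \<i> powi \<bar>m\<bar> * of_real (cabs lam) powr (2 * s - 1)"

section \<open>Bessel functions\<close>

text \<open>
  The classical Bessel function \<open>J\<^sub>\<nu>\<close> on the Riemann surface of the logarithm: \<open>bessel_J \<nu> t\<close> is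
  the value of \<open>J\<^sub>\<nu>\<close> at \<open>z = exp t\<close> for the determination \<open>log z = t\<close>, given by
  \<open>(z/2)\<^sup>\<nu> \<Sum>\<^sub>n (-1)\<^sup>n (z/2)\<^sup>2\<^sup>n / (n! \<Gamma>(\<nu> + n + 1))\<close>.
\<close>

definition bessel_J :: "complex \<Rightarrow> complex \<Rightarrow> complex"
  where "bessel_J \<nu> t = exp (\<nu> * (t - of_real (ln 2))) *
    (\<Sum>n. (- 1) ^ n * (exp t / 2) ^ (2 * n) * rGamma (\<nu> + of_nat n + 1) / fact n)"

text \<open>
  The second factor is evaluated at the conjugate of the chosen logarithm, so that
  \<open>arg (cnj z) = - arg z\<close> also on the negative real axis, where \<open>Ln (cnj z) \<noteq> cnj (Ln z)\<close>.
\<close>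

definition bessel_J2 :: "complex \<Rightarrow> int \<Rightarrow> complex \<Rightarrow> complex"
  where "bessel_J2 \<mu> m z =
    bessel_J (- 2 * \<mu> - of_int m / 2) (Ln z) * bessel_J (- 2 * \<mu> + of_int m / 2) (cnj (Ln z))"

definition bessel_denom :: "int \<Rightarrow> complex \<Rightarrow> complex"
  where "bessel_denom m \<mu> =
    (if even m then sin (2 * of_real pi * \<mu>) else cos (2 * of_real pi * \<mu>))"

definition bessel_B_generic :: "complex \<Rightarrow> int \<Rightarrow> complex \<Rightarrow> complex"
  where "bessel_B_generic \<mu> m u =
    (if even m
     then 2 * (of_real pi)\<^sup>2 / bessel_denom m \<mu> *
       (bessel_J2 \<mu> m (4 * of_real pi * u) - bessel_J2 (- \<mu>) (- m) (4 * of_real pi * u))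
     else 2 * (of_real pi)\<^sup>2 * \<i> / bessel_denom m \<mu> *
       (bessel_J2 \<mu> m (4 * of_real pi * u) + bessel_J2 (- \<mu>) (- m) (4 * of_real pi * u)))"

definition bessel_B :: "complex \<Rightarrow> int \<Rightarrow> complex \<Rightarrow> complex"
  where "bessel_B \<mu> m u =
    (if bessel_denom m \<mu> \<noteq> 0 then bessel_B_generic \<mu> m u
     else Lim (at \<mu>) (\<lambda>\<nu>. bessel_B_generic \<nu> m u))"

text \<open>
  The relative Bessel function \<open>i\<close> of \<open>\<pi>\<^sub>\<mu>\<^sub>,\<^sub>m\<close> (\<open>m\<close> even) and the Bessel function \<open>j\<close> of \<open>\<sigma>\<^sub>\<mu>\<^sub>,\<^sub>m\<close>,
  both with respect to \<open>psi lam\<close>, as functions on the cells \<open>{n(x) w\<^sub>0. x \<noteq> 0}\<close> and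
  \<open>{s(a) w. a \<noteq> 0}\<close>. The values elsewhere are irrelevant.
\<close>

definition rel_bessel :: "complex \<Rightarrow> complex \<Rightarrow> int \<Rightarrow> cmat2 \<Rightarrow> complex"
  where "rel_bessel lam \<mu> m g = (let x = (THE x. g = unip x ** w0) in
    1 / L_factor \<mu> m (1/2) * e_char (Tr (lam / (2 * x))) * of_real (cmod (lam / (2 * x))) *
    bessel_B (\<mu> / 2) (m div 2) (lam / (4 * x)))"

definition bessel_SL2 :: "complex \<Rightarrow> complex \<Rightarrow> int \<Rightarrow> cmat2 \<Rightarrow> complex"
  where "bessel_SL2 lam \<mu> m g = (let a = (THE a. a \<noteq> 0 \<and> g = tor a ** w) in
    (- 1) powi m * of_real (cmod (lam * a\<^sup>2)) * bessel_B \<mu> m (lam * a))"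

text \<open>
  The Bessel function with respect to \<open>psi (lam * D)\<close>, the twist by \<open>D\<close> of \<open>psi lam\<close>, when the
  Haar measures remain those attached to \<open>psi lam\<close>.
\<close>

definition bessel_SL2_twist :: "complex \<Rightarrow> complex \<Rightarrow> complex \<Rightarrow> int \<Rightarrow> cmat2 \<Rightarrow> complex"
  where "bessel_SL2_twist lam D \<mu> m g =
    of_real (sqrt (cabs D)) * bessel_SL2 (lam * D) \<mu> m g"

section \<open>The correspondence\<close>

definition bessel_identity ::
    "complex \<Rightarrow> complex \<Rightarrow> complex \<Rightarrow> int \<Rightarrow> complex \<Rightarrow> int \<Rightarrow> bool"
  where "bessel_identity lam D \<mu> m \<mu>' m' \<longleftrightarrow> (\<forall>z. z \<noteq> 0 \<longrightarrow>
    rel_bessel lam \<mu> m (unip (z / (4 * D)) ** w0) =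
      4 * transfer_factor D lam z * eps_factor \<mu> m (1/2) lam / L_factor \<mu> m (1/2) *
      bessel_SL2_twist lam D \<mu>' m' (w ** tor z))"

text \<open>
  The parameters of a representation are unique up to \<open>(\<mu>, m) \<mapsto> (- \<mu>, - m)\<close>, and all terms in
  \<open>bessel_identity\<close> are invariant under this change, for either representation; so it does not
  matter which parameters are used.
\<close>

definition corresponds ::
    "complex \<Rightarrow> complex \<Rightarrow> (cmat2 \<Rightarrow> 'h::complex_hilbert_space \<Rightarrow> 'h) \<Rightarrow>
     (cmat2 \<Rightarrow> 'h \<Rightarrow> 'h) \<Rightarrow> bool"
  where "corresponds lam D \<pi> \<sigma> \<longleftrightarrow> (\<exists>\<mu> m \<mu>' m'.
    even m \<and> unitary_parameter \<mu> m \<and> is_principal_series GL2 \<pi> \<mu> m \<and>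
    unitary_parameter \<mu>' m' \<and> is_principal_series SL2 \<sigma> \<mu>' m' \<and>
    bessel_identity lam D \<mu> m \<mu>' m')"

end

theory Submission
  imports Defs
begin

text \<open>
  The correspondence rests on one computation. Put \<open>x = z / (4D)\<close>; since
  \<open>w s(z) = s(1/z) w\<close>, the function \<open>j\<close> is evaluated at the torus coordinate \<open>a = 1/z\<close>.
  For \<open>\<pi>\<close> with parameters \<open>(\<mu>, m)\<close> the relative Bessel function contains
  \<open>\<B>\<close> with parameters \<open>(\<mu>/2, m/2)\<close> at \<open>\<lambda>/(4x) = \<lambda>D/z\<close>, and for \<open>\<sigma>\<close> with the halved
  parameters \<open>j\<close> contains the same \<open>\<B>\<close> at \<open>(\<lambda>D)a = \<lambda>D/z\<close>. So the Bessel functions on the two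
  sides are the same number, as are the \<open>L\<close>-values. What remains is elementary:
  the exponentials are both \<open>\<psi>(2D/z)\<close>, the absolute values agree because
  \<open>4 \<sqdot> |2D|\<inverse> \<sqdot> |z| \<sqdot> |D| \<sqdot> |\<lambda>D/z\<^sup>2| = |2\<lambda>D/z|\<close>,
  and the sign \<open>(-1)\<^sup>m\<^sup>/\<^sup>2\<close> of \<open>j\<close> cancels against the root number \<open>i\<^sup>|\<^sup>m\<^sup>|\<close>.

  Halving the parameters preserves the unitary range, so the classification of the unitary dual
  of \<open>GL2\<close> and the existence of the principal series of \<open>SL2\<close> turn this identity into a
  correspondence of representations.
\<close>

lemma unip_w0_inject: "unip x ** w0 = unip y ** w0 \<longleftrightarrow> x = y"
  by (auto simp: unip_def w0_def vec_eq_iff matrix_matrix_mult_def forall_2 sum_2)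

lemma tor_w_inject: "tor a ** w = tor b ** w \<longleftrightarrow> a = b"
  by (auto simp: tor_def w_def vec_eq_iff matrix_matrix_mult_def forall_2 sum_2)

lemma w_tor: "w ** tor z = tor (inverse z) ** w"
  by (auto simp: tor_def w_def vec_eq_iff matrix_matrix_mult_def forall_2 sum_2)

lemma rel_bessel_unip_w0:
  "rel_bessel lam \<mu> m (unip x ** w0) =
    1 / L_factor \<mu> m (1/2) * e_char (Tr (lam / (2 * x))) * of_real (cmod (lam / (2 * x))) *
    bessel_B (\<mu> / 2) (m div 2) (lam / (4 * x))"
proof -
  have "(THE y. unip x ** w0 = unip y ** w0) = x"
    by (simp add: unip_w0_inject)
  then show ?thesis
    by (simp add: rel_bessel_def)
qed

lemma bessel_SL2_tor_w:
  assumes "a \<noteq> 0"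
  shows "bessel_SL2 lam \<mu> m (tor a ** w) =
    (- 1) powi m * of_real (cmod (lam * a\<^sup>2)) * bessel_B \<mu> m (lam * a)"
proof -
  have "(THE b. b \<noteq> 0 \<and> tor a ** w = tor b ** w) = a"
    using assms by (intro the_equality) (auto simp: tor_w_inject)
  then show ?thesis
    by (simp add: bessel_SL2_def)
qed

text \<open>
  At the centre \<open>s = 1/2\<close> the term \<open>\<parallel>\<lambda>\<parallel>\<^sup>2\<^sup>s\<^sup>-\<^sup>1\<close> is \<open>1\<close>, which leaves the root of unity
  \<open>i\<^sup>|\<^sup>m\<^sup>| = (-1)\<^sup>|\<^sup>m\<^sup>/\<^sup>2\<^sup>|\<close>; since \<open>-1\<close> is its own inverse, this is the sign that occurs in the
  Bessel function of the representation of \<open>SL2\<close> with the halved parameters.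
\<close>

lemma eps_factor_central:
  assumes "lam \<noteq> 0" and "even m"
  shows "eps_factor \<mu> m (1/2) lam = (- 1) powi (m div 2)"
proof -
  have "\<i> powi \<bar>m\<bar> = (\<i> powi 2) powi \<bar>m div 2\<bar>"
  proof -
    have "\<bar>m\<bar> = 2 * \<bar>m div 2\<bar>"
      using assms(2) by (auto elim!: evenE simp: abs_mult)
    then show ?thesis
      by (metis power_int_mult)
  qed
  also have "\<dots> = (- 1) powi \<bar>m div 2\<bar>"
    by (simp add: power_int_def)
  also have "\<dots> = (- 1) powi (m div 2)"
    by (simp add: abs_if power_int_minus_one_minus)
  finally show ?thesis
    using assms(1) by (simp add: eps_factor_def cabs_def)
qed

lemma minus_one_powi_mult_self: "(- 1) powi k * (- 1) powi k = (1 :: complex)"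
  by (simp add: power_int_mult_distrib [symmetric])

lemma bessel_identity_half:
  assumes "lam \<noteq> 0" and "D \<noteq> 0" and "even m"
  shows "bessel_identity lam D \<mu> m (\<mu> / 2) (m div 2)"
  unfolding bessel_identity_def
proof (intro allI impI)
  fix z :: complex
  assume z: "z \<noteq> 0"
  let ?L = "L_factor \<mu> m (1/2)"
  let ?B = "bessel_B (\<mu> / 2) (m div 2) (lam * D / z)"
  let ?s = "(- 1) powi (m div 2) :: complex"
  let ?\<psi> = "psi lam (2 * D / z)"
  let ?t = "complex_of_real (1 / (2 * cmod D))"
  let ?c = "complex_of_real (cmod (lam * D / z\<^sup>2))"
  have args: "lam / (2 * (z / (4 * D))) = lam * (2 * D / z)"
      "lam / (4 * (z / (4 * D))) = lam * D / z"
    using z assms(2) by (simp_all add: field_simps)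
  have i: "rel_bessel lam \<mu> m (unip (z / (4 * D)) ** w0) =
      1 / ?L * ?\<psi> * of_real (cmod (lam * (2 * D / z))) * ?B"
    unfolding rel_bessel_unip_w0 args psi_def by (rule refl)
  have "lam * D * (inverse z)\<^sup>2 = lam * D / z\<^sup>2" "lam * D * inverse z = lam * D / z"
    by (simp_all add: divide_inverse power_inverse)
  then have j: "bessel_SL2_twist lam D (\<mu> / 2) (m div 2) (w ** tor z) =
      of_real (cmod D) * (?s * ?c * ?B)"
    using z by (simp add: bessel_SL2_twist_def w_tor bessel_SL2_tor_w cabs_def)
  have \<Delta>: "transfer_factor D lam z = ?t * ?\<psi> * of_real (cmod z)"
    by (simp add: transfer_factor_def gamma_factor_def cabs_def norm_mult real_sqrt_mult)
  have "cmod (lam * (2 * D / z)) =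
      4 * (1 / (2 * cmod D)) * cmod z * cmod D * cmod (lam * D / z\<^sup>2)"
    using z assms(2)
    by (simp add: norm_mult norm_divide norm_power divide_simps power2_eq_square)
  then have abs: "complex_of_real (cmod (lam * (2 * D / z))) =
      4 * ?t * of_real (cmod z) * of_real (cmod D) * ?c"
    by (simp only: of_real_mult of_real_numeral)
  have cancel_sign: "1 / l * p * (4 * t * y * d * c) * b =
      4 * (t * p * y) * r / l * (d * (r * c * b))"
    if "r * r = 1" for l p t y d c b r :: complex
  proof -
    have "4 * (t * p * y) * r / l * (d * (r * c * b)) =
        1 / l * p * (4 * t * y * d * c) * b * (r * r)"
      by (simp only: divide_inverse mult_1_left mult_ac)
    with that show ?thesis
      by simp
  qed
  show "rel_bessel lam \<mu> m (unip (z / (4 * D)) ** w0) =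
      4 * transfer_factor D lam z * eps_factor \<mu> m (1/2) lam / ?L *
      bessel_SL2_twist lam D (\<mu> / 2) (m div 2) (w ** tor z)"
    unfolding i j \<Delta> abs eps_factor_central [OF assms(1,3)]
    by (rule cancel_sign [OF minus_one_powi_mult_self])
qed

lemma unitary_parameter_half:
  "unitary_parameter \<mu> m \<Longrightarrow> unitary_parameter (\<mu> / 2) (m div 2)"
  by (auto simp: unitary_parameter_def)

theorem theorem8p2:
  fixes lam D :: complex
  assumes "lam \<noteq> 0" and "D \<noteq> 0"
    and GL2_unitary_dual:
      "\<And>\<pi> :: cmat2 \<Rightarrow> 'h::complex_hilbert_space \<Rightarrow> 'h.
        irreducible_unitary_rep GL2 \<pi> \<Longrightarrow> infinite_dimensional TYPE('h) \<Longrightarrow>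
        trivial_central_character \<pi> \<Longrightarrow>
        \<exists>\<mu> m. even m \<and> unitary_parameter \<mu> m \<and> is_principal_series GL2 \<pi> \<mu> m"
    and SL2_principal_series:
      "\<And>\<mu> m. unitary_parameter \<mu> m \<Longrightarrow>
        \<exists>\<sigma> :: cmat2 \<Rightarrow> 'h \<Rightarrow> 'h. irreducible_unitary_rep SL2 \<sigma> \<and> is_principal_series SL2 \<sigma> \<mu> m"
  shows
    "(\<forall>\<pi> :: cmat2 \<Rightarrow> 'h \<Rightarrow> 'h.
        irreducible_unitary_rep GL2 \<pi> \<and> infinite_dimensional TYPE('h) \<and>
        trivial_central_character \<pi> \<longrightarrow>
        (\<exists>\<sigma> :: cmat2 \<Rightarrow> 'h \<Rightarrow> 'h. irreducible_unitary_rep SL2 \<sigma> \<and> corresponds lam D \<pi> \<sigma>)) \<and>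
     (\<forall>\<mu> m. even m \<and> unitary_parameter \<mu> m \<longrightarrow>
        bessel_identity lam D \<mu> m (\<mu> / 2) (m div 2) \<and>
        (\<forall>\<pi> :: cmat2 \<Rightarrow> 'h \<Rightarrow> 'h.
           irreducible_unitary_rep GL2 \<pi> \<and> is_principal_series GL2 \<pi> \<mu> m \<longrightarrow>
           (\<exists>\<sigma> :: cmat2 \<Rightarrow> 'h \<Rightarrow> 'h. irreducible_unitary_rep SL2 \<sigma> \<and>
              is_principal_series SL2 \<sigma> (\<mu> / 2) (m div 2) \<and> corresponds lam D \<pi> \<sigma>)))"
proof -
  have correspondent: "\<exists>\<sigma> :: cmat2 \<Rightarrow> 'h \<Rightarrow> 'h. irreducible_unitary_rep SL2 \<sigma> \<and>
      is_principal_series SL2 \<sigma> (\<mu> / 2) (m div 2) \<and> corresponds lam D \<pi> \<sigma>"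
    if "even m" "unitary_parameter \<mu> m" "is_principal_series GL2 \<pi> \<mu> m"
    for \<mu> m and \<pi> :: "cmat2 \<Rightarrow> 'h \<Rightarrow> 'h"
  proof -
    have half: "unitary_parameter (\<mu> / 2) (m div 2)"
      using that(2) by (rule unitary_parameter_half)
    obtain \<sigma> :: "cmat2 \<Rightarrow> 'h \<Rightarrow> 'h" where \<sigma>: "irreducible_unitary_rep SL2 \<sigma>"
        "is_principal_series SL2 \<sigma> (\<mu> / 2) (m div 2)"
      using SL2_principal_series [OF half] by blast
    have "corresponds lam D \<pi> \<sigma>"
      unfolding corresponds_def
      using that half \<sigma>(2) bessel_identity_half [OF assms(1,2) that(1)] by blast
    with \<sigma> show ?thesis
      by blast
  qed
  show ?thesis
  proof (intro conjI allI impI; (elim conjE)?)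
    fix \<pi> :: "cmat2 \<Rightarrow> 'h \<Rightarrow> 'h"
    assume "irreducible_unitary_rep GL2 \<pi>" "infinite_dimensional TYPE('h)"
      "trivial_central_character \<pi>"
    then obtain \<mu> m where "even m" "unitary_parameter \<mu> m" "is_principal_series GL2 \<pi> \<mu> m"
      using GL2_unitary_dual by blast
    then show "\<exists>\<sigma> :: cmat2 \<Rightarrow> 'h \<Rightarrow> 'h. irreducible_unitary_rep SL2 \<sigma> \<and> corresponds lam D \<pi> \<sigma>"
      using correspondent by blast
  qed (use correspondent bessel_identity_half [OF assms(1,2)] in blast)+
qed

end
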